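(* Let $K$ be a totally real number field with $\sqrt2\notin K$ such that there exists a universal classical ternary quadratic form over $K$. Then every element of $2\mathcal{O}_K^+$ is represented by the form $\langle1,1,2,2\rangle=x^2+y^2+2z^2+2w^2$ over $\mathcal{O}_K$.
   Context: $\mathcal{O}_K$ is the ring of integers of $K$ and $\mathcal{O}_K^+$ its set of totally positive elements. A quadratic form over $K$ is $Q=\sum_{i\le j}\alpha_{ij}x_ix_j$ with $\alpha_{ij}\in\mathcal{O}_K$; it is classical if $\alpha_{ij}\in2\mathcal{O}_K$ for $i\neq j$, positive definite if $Q(v)\in\mathcal{O}_K^+$ for nonzero $v\in\mathcal{O}_K^r$, and universal if positive definite and every element of $\mathcal{O}_K^+$ equals $Q(v)$ for some $v\in\mathcal{O}_K^r$. A form represents $\alpha$ if $\alpha=Q(v)$ for some integral vector $v$. *)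

theory Defs
  imports Complex_Main "HOL-Computational_Algebra.Polynomial"
begin

text \<open>
  A number field is a type of class \<^class>\<open>field_char_0\<close> that is finite-dimensional over the
  rationals; predicates on the field as a whole take a type argument.
\<close>

definition number_field :: "'k::field_char_0 itself \<Rightarrow> bool" where
  "number_field _ \<longleftrightarrow>
     (\<exists>B. finite_dimensional_vector_space (\<lambda>(q::rat) (x::'k). of_rat q * x) B)"

definition field_embedding :: "('k::field \<Rightarrow> 'l::field) \<Rightarrow> bool" where
  "field_embedding \<sigma> \<longleftrightarrow>
     \<sigma> 1 = 1 \<and> (\<forall>x y. \<sigma> (x + y) = \<sigma> x + \<sigma> y) \<and> (\<forall>x y. \<sigma> (x * y) = \<sigma> x * \<sigma> y)"

definition totally_real :: "'k::field_char_0 itself \<Rightarrow> bool" where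
  "totally_real _ \<longleftrightarrow> (\<forall>\<sigma> :: 'k \<Rightarrow> complex. field_embedding \<sigma> \<longrightarrow> range \<sigma> \<subseteq> \<real>)"

definition ring_of_integers :: "'k::field_char_0 set" where
  "ring_of_integers = {x. algebraic_int x}"

definition totally_positive_integers :: "'k::field_char_0 set" where
  "totally_positive_integers =
     {x \<in> ring_of_integers. \<forall>\<sigma> :: 'k \<Rightarrow> real. field_embedding \<sigma> \<longrightarrow> 0 < \<sigma> x}"

text \<open>
  A quadratic form in \<open>r\<close> variables is given by its coefficients \<open>a i j\<close> for
  \<open>i \<le> j < r\<close>, and a vector by its entries \<open>v i\<close> for \<open>i < r\<close>; all other values of \<open>a\<close> and \<open>v\<close>
  are irrelevant.
\<close>

definition quadratic_form :: "nat \<Rightarrow> (nat \<Rightarrow> nat \<Rightarrow> 'k::field_char_0) \<Rightarrow> bool" where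
  "quadratic_form r a \<longleftrightarrow> (\<forall>j<r. \<forall>i\<le>j. a i j \<in> ring_of_integers)"

definition qf_eval :: "nat \<Rightarrow> (nat \<Rightarrow> nat \<Rightarrow> 'k::field_char_0) \<Rightarrow> (nat \<Rightarrow> 'k) \<Rightarrow> 'k" where
  "qf_eval r a v = (\<Sum>j<r. \<Sum>i\<le>j. a i j * v i * v j)"

definition integral_vector :: "nat \<Rightarrow> (nat \<Rightarrow> 'k::field_char_0) \<Rightarrow> bool" where
  "integral_vector r v \<longleftrightarrow> (\<forall>i<r. v i \<in> ring_of_integers)"

definition qf_classical :: "nat \<Rightarrow> (nat \<Rightarrow> nat \<Rightarrow> 'k::field_char_0) \<Rightarrow> bool" where
  "qf_classical r a \<longleftrightarrow> (\<forall>j<r. \<forall>i<j. a i j \<in> (\<lambda>x. 2 * x) ` ring_of_integers)"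

definition qf_positive_definite :: "nat \<Rightarrow> (nat \<Rightarrow> nat \<Rightarrow> 'k::field_char_0) \<Rightarrow> bool" where
  "qf_positive_definite r a \<longleftrightarrow>
     (\<forall>v. integral_vector r v \<and> (\<exists>i<r. v i \<noteq> 0) \<longrightarrow> qf_eval r a v \<in> totally_positive_integers)"

definition qf_represents :: "nat \<Rightarrow> (nat \<Rightarrow> nat \<Rightarrow> 'k::field_char_0) \<Rightarrow> 'k \<Rightarrow> bool" where
  "qf_represents r a x \<longleftrightarrow> (\<exists>v. integral_vector r v \<and> x = qf_eval r a v)"

definition qf_universal :: "nat \<Rightarrow> (nat \<Rightarrow> nat \<Rightarrow> 'k::field_char_0) \<Rightarrow> bool" where
  "qf_universal r a \<longleftrightarrow>
     qf_positive_definite r a \<and> (\<forall>x \<in> totally_positive_integers. qf_represents r a x)"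

definition diagonal_form :: "'k::field_char_0 list \<Rightarrow> nat \<Rightarrow> nat \<Rightarrow> 'k" where
  "diagonal_form ds i j = (if i = j then ds ! i else 0)"

lemma qf_eval_diagonal_1122:
  "qf_eval 4 (diagonal_form [1, 1, 2, 2]) v =
     (v 0)\<^sup>2 + (v 1)\<^sup>2 + 2 * (v 2)\<^sup>2 + 2 * (v 3)\<^sup>2"
  by (simp add: qf_eval_def diagonal_form_def eval_nat_numeral atMost_Suc)

end

theory Submission
  imports Defs "Jordan_Normal_Form.Char_Poly"
    "HOL-Computational_Algebra.Fundamental_Theorem_Algebra"
begin

text \<open>
  An integer \<open>t\<close> of \<open>K\<close> with \<open>t\<^sup>2 \<le> 2\<close> in every real embedding has
  \<open>t\<^sup>2 \<in> {0, 1, 2}\<close>: otherwise \<open>t\<^sup>2 (2 - t\<^sup>2) = 1 - (t\<^sup>2 - 1)\<^sup>2\<close> is a nonzero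
  integer whose conjugates all lie strictly between 0 and 1. As \<open>2\<close> is not a square, representing
  1 and 2 by the universal form \<open>Q\<close> gives orthogonal vectors \<open>e\<close> and \<open>f\<close> with \<open>Q(e) = 1\<close> and
  \<open>Q(f) = c \<in> {1, 2}\<close>. If \<open>D\<close> is the determinant of \<open>Q\<close>, the Gram determinant of \<open>e, f, u\<close> gives
  \<open>c Q(u) = c B(u,e)\<^sup>2 + B(u,f)\<^sup>2 + D det(e,f,u)\<^sup>2\<close>,
  so it suffices to write \<open>2 D T\<^sup>2\<close> (if \<open>c = 1\<close>) as \<open>x\<^sup>2 + y\<^sup>2\<close>, or \<open>D T\<^sup>2\<close> (if \<open>c = 2\<close>) as
  \<open>x\<^sup>2 + 2 y\<^sup>2\<close>, for every value \<open>T\<close> of \<open>det(e,f,_)\<close>. This comes from a vector \<open>u\<close> with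
  \<open>c Q(u) = 2 D\<close>, for which \<open>det(e,f,u)\<^sup>2 \<le> 2\<close> in every embedding, hence
  \<open>det(e,f,u)\<^sup>2 \<in> {0, 1}\<close>.
\<close>

subsection \<open>The ring of integers\<close>

text \<open>With the field viewed as a module over the integers, \<open>zspan.span\<close> describes
  finitely generated additive subgroups.\<close>

interpretation zspan: Modules.module "\<lambda>(c::int) (x::'a::field_char_0). of_int c * x"
  by standard (simp_all add: algebra_simps)

text \<open>Determinant trick: multiplication by \<open>z\<close> acts on the elements of
  \<open>S\<close> through an integer matrix. The vector listing \<open>S\<close> is nonzero because
  of \<open>s\<close>, so it is an eigenvector for \<open>z\<close>, and \<open>z\<close> is a root
  of the monic integral characteristic polynomial.\<close>

lemma algebraic_int_if_span_stable:
  fixes z :: "'a :: field_char_0"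
  assumes "finite S" and "s \<in> S" and "s \<noteq> 0"
    and stable: "\<And>s. s \<in> S \<Longrightarrow> z * s \<in> zspan.span S"
  shows "algebraic_int z"
proof -
  obtain xs where xs: "set xs = S"
    using finite_list[OF \<open>finite S\<close>] by blast
  define ys where "ys = remdups xs"
  have ys: "set ys = S" "distinct ys"
    by (simp_all add: ys_def xs)
  define n where "n = length ys"
  have "\<exists>c. z * s = (\<Sum>v\<in>S. of_int (c v) * v)" if "s \<in> S" for s
    using stable[OF that] by (auto simp: zspan.span_finite[OF \<open>finite S\<close>])
  then obtain c where c: "\<And>s. s \<in> S \<Longrightarrow> z * s = (\<Sum>v\<in>S. of_int (c s v) * v)"
    by metis
  define A :: "int mat" where "A = mat n n (\<lambda>(i, j). c (ys ! i) (ys ! j))"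
  define B :: "'a mat" where "B = map_mat of_int A"
  have A: "A \<in> carrier_mat n n" and B: "B \<in> carrier_mat n n"
    by (simp_all add: A_def B_def)
  define v where "v = vec_of_list ys"
  have dim_v: "dim_vec v = n"
    by (simp add: v_def n_def)
  have "B *\<^sub>v v = z \<cdot>\<^sub>v v"
  proof
    fix i assume "i < dim_vec (z \<cdot>\<^sub>v v)"
    hence i: "i < n"
      by (simp add: dim_v)
    have "(B *\<^sub>v v) $ i = (\<Sum>j<n. of_int (c (ys ! i) (ys ! j)) * ys ! j)"
      using i by (simp add: B_def A_def scalar_prod_def dim_v v_def n_def vec_of_list_index
          lessThan_atLeast0)
    also have "\<dots> = (\<Sum>v\<in>S. of_int (c (ys ! i) v) * v)"
      unfolding n_def
      by (rule sum.reindex_bij_betw[OF bij_betw_nth]) (simp_all add: ys)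
    also have "\<dots> = z * ys ! i"
      using i ys by (subst c) (auto simp: n_def)
    finally show "(B *\<^sub>v v) $ i = (z \<cdot>\<^sub>v v) $ i"
      using i dim_v by (simp add: v_def vec_of_list_index)
  qed (simp add: dim_v B_def A_def)
  moreover have "v \<noteq> 0\<^sub>v n"
  proof
    assume v0: "v = 0\<^sub>v n"
    obtain i where "i < n" "ys ! i = s"
      using \<open>s \<in> S\<close> ys by (metis in_set_conv_nth n_def)
    thus False
      using v0 \<open>s \<noteq> 0\<close> by (metis index_zero_vec(1) v_def vec_of_list_index)
  qed
  ultimately have "eigenvector B v z"
    unfolding eigenvector_def carrier_matD(1)[OF B]
    by (simp add: carrier_vecI[OF dim_v])
  hence "poly (char_poly B) z = 0"
    using eigenvalue_root_char_poly[OF B] unfolding eigenvalue_def by blast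
  moreover have "char_poly B = map_poly of_int (char_poly A)"
    unfolding B_def by (rule of_int_hom.char_poly_hom[OF A])
  ultimately show ?thesis
    using degree_monic_char_poly[OF A] unfolding algebraic_int_altdef_ipoly by metis
qed

text \<open>Solving the monic relation for its top power allows exponents to be reduced below
  \<open>m\<close>.\<close>

lemma algebraic_int_power_degree:
  fixes x :: "'a :: field_char_0"
  assumes "algebraic_int x"
  obtains m :: nat and c :: "nat \<Rightarrow> int"
  where "m > 0" and "x ^ m = (\<Sum>k<m. of_int (c k) * x ^ k)"
proof -
  from assms obtain p :: "int poly" where p: "poly (map_poly of_int p) x = 0" "lead_coeff p = 1"
    by (auto simp: algebraic_int_altdef_ipoly)
  have deg: "degree p > 0"
  proof (rule ccontr)
    assume "\<not> degree p > 0"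
    hence "p = [:1:]"
      using p(2) by (metis degree_0_id gr0I)
    thus False using p(1) by simp
  qed
  have "0 = (\<Sum>k\<le>degree p. of_int (coeff p k) * x ^ k)"
    using p(1) by (simp add: poly_altdef)
  also have "\<dots> = x ^ degree p + (\<Sum>k<degree p. of_int (coeff p k) * x ^ k)"
    using p(2) by (simp add: lessThan_Suc_atMost [symmetric])
  finally have "x ^ degree p = (\<Sum>k<degree p. of_int (- coeff p k) * x ^ k)"
    by (simp add: sum_negf eq_neg_iff_add_eq_0)
  with deg show ?thesis by (rule that)
qed

text \<open>The additive group generated by the \<open>x ^ i * y ^ j\<close> with
  \<open>i < m\<close> and \<open>j < n\<close> is stable under multiplication by \<open>x\<close>
  and by \<open>y\<close>, hence also by \<open>x + y\<close> and \<open>x * y\<close>.\<close>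

lemma algebraic_int_add_mult:
  fixes x y :: "'a :: field_char_0"
  assumes "algebraic_int x" and "algebraic_int y"
  shows algebraic_int_add: "algebraic_int (x + y)" and algebraic_int_mult: "algebraic_int (x * y)"
proof -
  obtain m c where m: "m > 0" and xm: "x ^ m = (\<Sum>k<m. of_int (c k) * x ^ k)"
    using algebraic_int_power_degree[OF assms(1)] by metis
  obtain n d where n: "n > 0" and yn: "y ^ n = (\<Sum>k<n. of_int (d k) * y ^ k)"
    using algebraic_int_power_degree[OF assms(2)] by metis
  define S where "S = (\<lambda>(i, j). x ^ i * y ^ j) ` ({..<m} \<times> {..<n})"
  have "finite S" by (simp add: S_def)
  have in_S: "x ^ i * y ^ j \<in> zspan.span S" if "i < m" "j < n" for i j
    using that by (auto simp: S_def intro!: zspan.span_base)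
  have stable: "a * u \<in> zspan.span S"
    if "\<And>s. s \<in> S \<Longrightarrow> a * s \<in> zspan.span S" "u \<in> zspan.span S" for a u
    using that(2)
  proof (induction rule: zspan.span_induct_alt)
    case base
    show ?case by (simp add: zspan.span_zero)
  next
    case (step k s v)
    have "of_int k * (a * s) + a * v \<in> zspan.span S"
      using step that(1) by (intro zspan.span_add zspan.span_scale) auto
    thus ?case by (simp add: algebra_simps)
  qed
  have x_stable: "x * s \<in> zspan.span S" if s: "s \<in> S" for s
  proof -
    obtain i j where ij: "i < m" "j < n" "s = x ^ i * y ^ j"
      using s by (auto simp: S_def)
    show ?thesis
    proof (cases "Suc i < m")
      case True
      with in_S[OF this ij(2)] ij show ?thesis by (simp add: algebra_simps)
    next
      case False
      \<comment> \<open>Here \<open>Suc i = m\<close>: the exponent leaves the range, and the monic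
        relation brings it back.\<close>
      with ij have "x * s = x ^ m * y ^ j"
        by (metis Suc_lessI mult.assoc power_Suc)
      also have "\<dots> = (\<Sum>k<m. of_int (c k) * (x ^ k * y ^ j))"
        by (simp add: xm sum_distrib_right mult.assoc)
      also have "\<dots> \<in> zspan.span S"
        using ij by (intro zspan.span_sum zspan.span_scale in_S) auto
      finally show ?thesis .
    qed
  qed
  have y_stable: "y * s \<in> zspan.span S" if s: "s \<in> S" for s
  proof -
    obtain i j where ij: "i < m" "j < n" "s = x ^ i * y ^ j"
      using s by (auto simp: S_def)
    show ?thesis
    proof (cases "Suc j < n")
      case True
      with in_S[OF ij(1) this] ij show ?thesis by (simp add: algebra_simps)
    next
      case False
      with ij have "n = Suc j" by simp
      with ij have "y * s = y ^ n * x ^ i"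
        by (simp add: algebra_simps)
      also have "\<dots> = (\<Sum>k<n. of_int (d k) * (x ^ i * y ^ k))"
        unfolding yn sum_distrib_right by (simp add: mult_ac)
      also have "\<dots> \<in> zspan.span S"
        using ij by (intro zspan.span_sum zspan.span_scale in_S) auto
      finally show ?thesis .
    qed
  qed
  have "1 \<in> S"
    using m n by (auto simp: S_def intro!: image_eqI[of _ _ "(0, 0)"])
  note alg = algebraic_int_if_span_stable[OF \<open>finite S\<close> this one_neq_zero]
  show "algebraic_int (x + y)"
    by (rule alg) (simp add: distrib_right zspan.span_add x_stable y_stable)
  show "algebraic_int (x * y)"
    by (rule alg) (simp add: mult.assoc stable[OF x_stable] y_stable)
qed

lemma ring_of_integers_add: "x \<in> ring_of_integers \<Longrightarrow> y \<in> ring_of_integers \<Longrightarrow> x + y \<in> ring_of_integers"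
  and ring_of_integers_mult: "x \<in> ring_of_integers \<Longrightarrow> y \<in> ring_of_integers \<Longrightarrow> x * y \<in> ring_of_integers"
  and ring_of_integers_diff: "x \<in> ring_of_integers \<Longrightarrow> y \<in> ring_of_integers \<Longrightarrow> x - y \<in> ring_of_integers"
  and ring_of_integers_of_int: "of_int n \<in> ring_of_integers"
  using algebraic_int_add[of x "- y"]
  by (simp_all add: ring_of_integers_def algebraic_int_add algebraic_int_mult int_imp_algebraic_int)

section \<open>Basic properties of field embeddings\<close>

lemma field_embedding_zero: "field_embedding \<sigma> \<Longrightarrow> \<sigma> 0 = 0"
  by (metis add.right_neutral add_left_cancel field_embedding_def)

lemma field_embedding_imp_comm_ring_hom: "field_embedding \<sigma> \<Longrightarrow> comm_ring_hom \<sigma>"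
  using field_embedding_zero[of \<sigma>] by unfold_locales (auto simp: field_embedding_def)

lemma field_embedding_eq_0_iff:
  assumes "field_embedding \<sigma>"
  shows "\<sigma> x = 0 \<longleftrightarrow> x = 0"
proof
  assume "\<sigma> x = 0"
  show "x = 0"
  proof (rule ccontr)
    assume "x \<noteq> 0"
    hence "\<sigma> x * \<sigma> (inverse x) = 1"
      using assms by (metis field_embedding_def right_inverse)
    thus False using \<open>\<sigma> x = 0\<close> by simp
  qed
qed (simp add: field_embedding_zero[OF assms])

lemma field_embedding_algebraic_int:
  fixes \<sigma> :: "'k :: field_char_0 \<Rightarrow> 'l :: field_char_0"
  assumes "field_embedding \<sigma>" and "algebraic_int x"
  shows "algebraic_int (\<sigma> x)"
proof -
  interpret comm_ring_hom \<sigma>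
    by (rule field_embedding_imp_comm_ring_hom[OF assms(1)])
  from assms(2) obtain p :: "int poly" where
    p: "poly (map_poly of_int p) x = 0" "lead_coeff p = 1"
    by (auto simp: algebraic_int_altdef_ipoly)
  have "poly (map_poly of_int p) (\<sigma> x) = \<sigma> (poly (map_poly of_int p) x)"
    by (simp add: poly_altdef hom_sum hom_mult hom_power hom_of_int)
  with p show ?thesis
    by (auto simp: algebraic_int_altdef_ipoly hom_zero)
qed

subsection \<open>Extension of embeddings\<close>

text \<open>The \<open>n + 1\<close> powers of \<open>z\<close> up to \<open>z ^ n\<close> satisfy a
  linear relation over the rationals, \<open>n\<close> being the dimension.\<close>

lemma number_field_algebraic:
  fixes z :: "'k :: field_char_0"
  assumes "number_field TYPE('k)"
  shows "algebraic z"
proof -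
  from assms obtain B where "finite_dimensional_vector_space (\<lambda>(q::rat) (x::'k). of_rat q * x) B"
    by (auto simp: number_field_def)
  then interpret fd: finite_dimensional_vector_space "\<lambda>(q::rat) (x::'k). of_rat q * x" B .
  define n where "n = card B"
  \<comment> \<open>Linear dependence is a property of a set, so it gives a relation directly only
    if the powers are distinct; if two coincide, their difference is the relation.\<close>
  have "\<exists>c. (\<exists>i\<le>n. c i \<noteq> (0::rat)) \<and> (\<Sum>i\<le>n. of_rat (c i) * z ^ i) = 0"
    if inj: "inj_on ((^) z) {..n}"
  proof -
    let ?S = "((^) z) ` {..n}"
    have "fd.dependent ?S"
    proof (rule ccontr)
      assume "fd.independent ?S"
      hence "card ?S \<le> card B"
        using fd.independent_span_bound[OF fd.finite_Basis] fd.span_Basis by simp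
      thus False
        using card_image[OF inj] by (simp add: n_def)
    qed
    then obtain u where u: "\<exists>v\<in>?S. u v \<noteq> 0" "(\<Sum>v\<in>?S. of_rat (u v) * v) = 0"
      using fd.dependent_finite[of ?S] by auto
    show ?thesis
      using u by (intro exI[of _ "\<lambda>i. u (z ^ i)"]) (auto simp: sum.reindex[OF inj])
  qed
  moreover have "\<exists>c. (\<exists>i\<le>n. c i \<noteq> (0::rat)) \<and> (\<Sum>i\<le>n. of_rat (c i) * z ^ i) = 0"
    if "\<not> inj_on ((^) z) {..n}"
  proof -
    from that obtain i j where ij: "i \<le> n" "j \<le> n" "i \<noteq> j" "z ^ i = z ^ j"
      by (auto simp: inj_on_def)
    define c where "c = (\<lambda>k. (if k = i then 1 else 0) - (if k = j then 1 else 0 :: rat))"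
    have "(\<Sum>k\<le>n. of_rat (c k) * z ^ k) =
        (\<Sum>k\<le>n. (if k = i then z ^ k else 0) - (if k = j then z ^ k else 0))"
      by (intro sum.cong) (auto simp: c_def of_rat_minus)
    also have "\<dots> = 0"
      using ij by (simp add: sum_subtractf)
    finally show ?thesis
      using ij by (intro exI[of _ c]) (auto simp: c_def intro!: exI[of _ i])
  qed
  ultimately obtain c i where c: "i \<le> n" "c i \<noteq> (0::rat)" "(\<Sum>i\<le>n. of_rat (c i) * z ^ i) = 0"
    by blast
  define p where "p = (\<Sum>i\<le>n. monom (of_rat (c i)) i :: 'k poly)"
  have coeff_p: "coeff p k = (if k \<le> n then of_rat (c k) else 0)" for k
    by (simp add: p_def coeff_sum)
  have "p \<noteq> 0"
    using c by (metis coeff_0 coeff_p of_rat_eq_0_iff)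
  moreover have "poly p z = 0"
    using c by (simp add: p_def poly_sum poly_monom)
  moreover have "\<forall>k. coeff p k \<in> \<rat>"
    by (simp add: coeff_p)
  ultimately show ?thesis
    unfolding algebraic_altdef by blast
qed

text \<open>A ring homomorphism from a subring \<open>F\<close> containing the rationals. The map is
  total, but only its values on \<open>F\<close> are constrained. Closure of \<open>F\<close> under
  inverses will follow from algebraicity.\<close>

locale partial_embedding =
  fixes F :: "'k :: field_char_0 set" and \<phi> :: "'k \<Rightarrow> complex"
  assumes rat_closed: "of_rat q \<in> F"
    and add_closed: "x \<in> F \<Longrightarrow> y \<in> F \<Longrightarrow> x + y \<in> F"
    and mult_closed: "x \<in> F \<Longrightarrow> y \<in> F \<Longrightarrow> x * y \<in> F"
    and map_rat: "\<phi> (of_rat q) = of_rat q"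
    and map_add: "x \<in> F \<Longrightarrow> y \<in> F \<Longrightarrow> \<phi> (x + y) = \<phi> x + \<phi> y"
    and map_mult: "x \<in> F \<Longrightarrow> y \<in> F \<Longrightarrow> \<phi> (x * y) = \<phi> x * \<phi> y"
begin

text \<open>The ring F[X], kept inside K[X] because \<open>F\<close> is a set and not a
  type.\<close>

definition polys :: "'k poly set" where
  "polys = {p. \<forall>i. coeff p i \<in> F}"

lemma Rats_closed: "x \<in> \<rat> \<Longrightarrow> x \<in> F"
  using rat_closed by (auto elim: Rats_cases)

lemma zero_closed: "0 \<in> F" and one_closed: "1 \<in> F"
  using rat_closed[of 0] rat_closed[of 1] by simp_all

lemma map_zero [simp]: "\<phi> 0 = 0" and map_one: "\<phi> 1 = 1"
  using map_rat[of 0] map_rat[of 1] by simp_all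

lemma minus_closed: "x \<in> F \<Longrightarrow> - x \<in> F"
  using mult_closed[OF rat_closed[of "- 1"], of x] by (simp add: of_rat_minus)

lemma sum_closed: "(\<And>i. i \<in> I \<Longrightarrow> f i \<in> F) \<Longrightarrow> sum f I \<in> F"
  by (induction I rule: infinite_finite_induct) (auto simp: zero_closed add_closed)

lemma map_sum: "(\<And>i. i \<in> I \<Longrightarrow> f i \<in> F) \<Longrightarrow> \<phi> (sum f I) = (\<Sum>i\<in>I. \<phi> (f i))"
  by (induction I rule: infinite_finite_induct) (auto simp: map_add sum_closed)

lemma poly_closed: "p \<in> polys \<Longrightarrow> z \<in> F \<Longrightarrow> poly p z \<in> F"
  by (induction p) (fastforce simp: polys_def coeff_pCons add_closed mult_closed zero_closed
      split: nat.splits)+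

lemma polys_add: "p \<in> polys \<Longrightarrow> q \<in> polys \<Longrightarrow> p + q \<in> polys"
  by (simp add: polys_def add_closed)

lemma polys_mult: "p \<in> polys \<Longrightarrow> q \<in> polys \<Longrightarrow> p * q \<in> polys"
  by (simp add: polys_def coeff_mult sum_closed mult_closed)

lemma polys_monom: "c \<in> F \<Longrightarrow> monom c n \<in> polys"
  by (simp add: polys_def zero_closed)

lemma map_poly_add:
  "p \<in> polys \<Longrightarrow> q \<in> polys \<Longrightarrow> map_poly \<phi> (p + q) = map_poly \<phi> p + map_poly \<phi> q"
  by (rule poly_eqI) (simp add: coeff_map_poly polys_def map_add)

lemma map_poly_mult:
  "p \<in> polys \<Longrightarrow> q \<in> polys \<Longrightarrow> map_poly \<phi> (p * q) = map_poly \<phi> p * map_poly \<phi> q"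
  by (rule poly_eqI) (simp add: coeff_map_poly polys_def coeff_mult map_sum map_mult mult_closed)

text \<open>A subring of \<open>K\<close> that contains the rationals is a field, because a relation with nonzero
  constant term expresses the inverse as a polynomial.\<close>

lemma inverse_closed:
  assumes "algebraic x" and "x \<in> F"
  shows "inverse x \<in> F"
proof (cases "x = 0")
  case False
  \<comment> \<open>Write the relation as \<open>c + x * q(x) = 0\<close>. If \<open>c = 0\<close>,
    the factor \<open>x\<close> cancels and the induction continues with \<open>q\<close>; otherwise
    \<open>- q(x) / c\<close> is the inverse.\<close>
  have "\<forall>i. coeff p i \<in> \<rat> \<Longrightarrow> p \<noteq> 0 \<Longrightarrow> poly p x = 0 \<Longrightarrow> inverse x \<in> F" for p
  proof (induction p)
    case 0
    thus ?case by simp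
  next
    case (pCons c q)
    have c: "c \<in> \<rat>" and q: "\<forall>i. coeff q i \<in> \<rat>"
      using pCons.prems(1) by (auto simp: coeff_pCons split: nat.splits dest: spec[of _ "Suc _"])
    have eq: "c + x * poly q x = 0"
      using pCons.prems by simp
    show ?case
    proof (cases "c = 0")
      case True
      with eq False pCons q show ?thesis by auto
    next
      case c0: False
      have "q \<in> polys"
        using q by (simp add: polys_def Rats_closed)
      hence "poly q x \<in> F"
        using \<open>x \<in> F\<close> by (rule poly_closed)
      moreover obtain d where d: "c = of_rat d"
        using c by (auto elim: Rats_cases)
      ultimately have "of_rat (- inverse d) * poly q x \<in> F"
        by (intro mult_closed rat_closed)
      moreover have "inverse x = of_rat (- inverse d) * poly q x"
      proof (rule inverse_unique)
        have "x * poly q x = - c"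
          using eq by (simp add: add_eq_0_iff)
        hence "x * (- inverse c * poly q x) = 1"
          using c0 by (simp add: mult.left_commute[of x])
        thus "x * (of_rat (- inverse d) * poly q x) = 1"
          by (simp only: d of_rat_minus of_rat_inverse)
      qed
      ultimately show ?thesis by simp
    qed
  qed
  with \<open>algebraic x\<close> show ?thesis
    by (auto simp: algebraic_altdef)
qed (simp add: zero_closed)

definition minimal_poly :: "'k \<Rightarrow> 'k poly \<Rightarrow> bool" where
  "minimal_poly z p \<longleftrightarrow> p \<in> polys \<and> lead_coeff p = 1 \<and> poly p z = 0 \<and>
     (\<forall>q\<in>polys. q \<noteq> 0 \<longrightarrow> poly q z = 0 \<longrightarrow> degree p \<le> degree q)"

lemma minimal_poly_exists:
  assumes alg: "\<And>x :: 'k. algebraic x"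
  shows "\<exists>p. minimal_poly z p"
proof -
  define P where "P = (\<lambda>p. p \<in> polys \<and> p \<noteq> 0 \<and> poly p z = 0)"
  obtain p0 where "p0 \<noteq> 0" "\<forall>i. coeff p0 i \<in> \<rat>" "poly p0 z = 0"
    using alg[of z] by (auto simp: algebraic_altdef)
  hence "P p0"
    by (simp add: P_def polys_def Rats_closed)
  then obtain p where p: "P p" and least: "\<And>q. P q \<Longrightarrow> degree p \<le> degree q"
    using ex_has_least_nat[of P p0 degree] by blast
  define c where "c = inverse (lead_coeff p)"
  have "c \<noteq> 0"
    using p by (simp add: c_def P_def)
  have "c \<in> F"
    using p alg by (auto simp: c_def P_def polys_def intro!: inverse_closed)
  have "minimal_poly z (Polynomial.smult c p)"
    unfolding minimal_poly_def
    using p least \<open>c \<noteq> 0\<close> \<open>c \<in> F\<close> by (auto simp: P_def polys_def mult_closed c_def)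
  thus ?thesis ..
qed

text \<open>Division by the monic \<open>p\<close> inside F[X]: subtracting a monomial multiple of
  \<open>p\<close> cancels the leading term of \<open>q\<close> and keeps the root \<open>z\<close>,
  so induction on the degree applies. This makes the map \<open>q(z)\<close> to
  \<open>(\<phi> q)(r)\<close> below well defined.\<close>

lemma minimal_poly_root_map:
  assumes p: "minimal_poly z p" and r: "poly (map_poly \<phi> p) r = 0"
  shows "q \<in> polys \<Longrightarrow> poly q z = 0 \<Longrightarrow> poly (map_poly \<phi> q) r = 0"
proof (induction "degree q" arbitrary: q rule: less_induct)
  case less
  have pp: "p \<in> polys" "lead_coeff p = 1" "poly p z = 0"
    using p by (auto simp: minimal_poly_def)
  show ?case
  proof (cases "q = 0")
    case False
    hence deg: "degree p \<le> degree q"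
      using p less.prems by (auto simp: minimal_poly_def)
    define s where "s = monom (lead_coeff q) (degree q - degree p)"
    define t where "t = q + (- s) * p"
    have s: "s \<in> polys" and ms: "- s \<in> polys"
      using less.prems(1) by (auto simp: s_def minus_monom polys_def zero_closed minus_closed)
    have sp: "s * p \<in> polys" and t: "t \<in> polys"
      unfolding t_def
      by (rule polys_mult[OF s pp(1)], rule polys_add[OF less.prems(1) polys_mult[OF ms pp(1)]])
    have q_eq: "q = t + s * p"
      by (simp add: t_def)
    have "p \<noteq> 0"
      using pp by auto
    have deg_sp: "degree (s * p) = degree q"
      using False \<open>p \<noteq> 0\<close> deg by (simp add: s_def degree_mult_eq degree_monom_eq)
    have "lead_coeff (s * p) = lead_coeff q"
      using False pp(2) by (simp only: lead_coeff_mult) (simp add: s_def degree_monom_eq)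
    note deg_sp = deg_sp this
    have "poly (map_poly \<phi> t) r = 0"
    proof (cases "t = 0")
      case False
      have "degree t < degree q"
      proof (rule degree_lessI)
        show "t \<noteq> 0 \<or> 0 < degree q" using False by simp
        show "\<forall>k\<ge>degree q. coeff t k = 0"
        proof (intro allI impI)
          fix k assume "degree q \<le> k"
          thus "coeff t k = 0"
            using deg_sp by (cases "k = degree q") (auto simp: t_def coeff_eq_0)
        qed
      qed
      moreover have "poly t z = 0"
        using less.prems pp by (simp add: t_def)
      ultimately show ?thesis
        using less.hyps t by blast
    qed simp
    thus ?thesis
      using r by (subst q_eq) (simp add: map_poly_add[OF t sp] map_poly_mult[OF s pp(1)])
  qed simp
qed

text \<open>The extension to F[z] evaluates at \<open>r\<close> the polynomial that represents an
  element at \<open>z\<close>.\<close>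

lemma extend_by_root:
  assumes p: "minimal_poly z p" and r: "poly (map_poly \<phi> p) r = 0"
  obtains F' \<phi>' where "partial_embedding F' \<phi>'" "F \<subseteq> F'" "z \<in> F'" "\<phi>' z = r"
    "\<And>x. x \<in> F \<Longrightarrow> \<phi>' x = \<phi> x"
proof -
  define F' where "F' = (\<lambda>q. poly q z) ` polys"
  define \<phi>' where "\<phi>' = (\<lambda>x. poly (map_poly \<phi> (SOME q. q \<in> polys \<and> poly q z = x)) r)"
  have map: "\<phi>' (poly q z) = poly (map_poly \<phi> q) r" if q: "q \<in> polys" for q
  proof -
    define q' where "q' = (SOME q'. q' \<in> polys \<and> poly q' z = poly q z)"
    have q': "q' \<in> polys" "poly q' z = poly q z"
      using someI[of "\<lambda>q'. q' \<in> polys \<and> poly q' z = poly q z" q] q by (auto simp: q'_def)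
    \<comment> \<open>Two representatives differ by a polynomial vanishing at \<open>z\<close>,
      whose image vanishes at \<open>r\<close>. The difference is written with the constant
      polynomial -1, so that closure under sums and products suffices.\<close>
    have m: "monom (- 1) 0 \<in> polys"
      by (intro polys_monom minus_closed one_closed)
    have mq: "monom (- 1) 0 * q \<in> polys"
      by (rule polys_mult[OF m q])
    have "poly (map_poly \<phi> (q' + monom (- 1) 0 * q)) r = 0"
      using q' by (intro minimal_poly_root_map[OF p r] polys_add mq) (simp_all add: poly_monom)
    moreover have "\<phi> (- 1) = - 1"
      using map_rat[of "- 1"] by (simp add: of_rat_minus)
    ultimately have "poly (map_poly \<phi> q') r = poly (map_poly \<phi> q) r"
      by (simp add: map_poly_add[OF q'(1) mq] map_poly_mult[OF m q] map_poly_monom poly_monom)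
    thus ?thesis by (simp add: \<phi>'_def q'_def)
  qed
  have const: "x \<in> F' \<and> \<phi>' x = \<phi> x" if "x \<in> F" for x
    using map[OF polys_monom[OF that, of 0]] polys_monom[OF that, of 0]
    by (auto simp: F'_def poly_monom map_poly_monom intro!: image_eqI[of _ _ "monom x 0"])
  have "partial_embedding F' \<phi>'"
  proof
    fix q x y
    show "of_rat q \<in> F'" "\<phi>' (of_rat q) = of_rat q"
      using const[OF rat_closed[of q]] map_rat by auto
    assume "x \<in> F'" "y \<in> F'"
    then obtain u v where u: "u \<in> polys" "x = poly u z" and v: "v \<in> polys" "y = poly v z"
      by (auto simp: F'_def)
    note uv = polys_add[OF u(1) v(1)] polys_mult[OF u(1) v(1)]
    show "x + y \<in> F'" "x * y \<in> F'"
      using uv u v by (auto simp: F'_def intro: image_eqI[of _ _ "u + v"] image_eqI[of _ _ "u * v"])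
    show "\<phi>' (x + y) = \<phi>' x + \<phi>' y" "\<phi>' (x * y) = \<phi>' x * \<phi>' y"
      using map[OF uv(1)] map[OF uv(2)] map[OF u(1)] map[OF v(1)] u v
      by (simp_all add: map_poly_add map_poly_mult)
  qed
  moreover have "z \<in> F'" "\<phi>' z = r"
    using map[OF polys_monom[OF one_closed, of 1]] polys_monom[OF one_closed, of 1]
    by (auto simp: F'_def poly_monom map_poly_monom map_one intro!: image_eqI[of _ _ "monom 1 1"])
  ultimately show ?thesis
    using const by (intro that[of F' \<phi>']) auto
qed

lemma minimal_poly_map_degree:
  assumes "minimal_poly z p"
  shows "degree (map_poly \<phi> p) = degree p" and "degree p > 0" and "lead_coeff (map_poly \<phi> p) = 1"
proof -
  have p: "lead_coeff p = 1" "poly p z = 0"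
    using assms by (auto simp: minimal_poly_def)
  show deg: "degree (map_poly \<phi> p) = degree p"
    using p by (intro degree_map_poly) (auto simp: map_one)
  show "lead_coeff (map_poly \<phi> p) = 1"
    by (simp add: deg coeff_map_poly p map_one)
  show "degree p > 0"
  proof (rule ccontr)
    assume "\<not> degree p > 0"
    hence "p = [:1:]"
      using p(1) by (metis degree_0_id gr0I)
    thus False using p(2) by simp
  qed
qed

text \<open>The elements of \<open>B\<close> are adjoined one at a time; a complex root of each
  transported minimal polynomial exists by the fundamental theorem of algebra.\<close>

lemma extend_to_finite:
  assumes alg: "\<And>x :: 'k. algebraic x" and "finite B"
  shows "\<exists>F' \<phi>'. partial_embedding F' \<phi>' \<and> F \<subseteq> F' \<and> B \<subseteq> F' \<and> (\<forall>x\<in>F. \<phi>' x = \<phi> x)"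
  using \<open>finite B\<close>
proof induction
  case empty
  show ?case
    using partial_embedding_axioms by (intro exI[of _ F] exI[of _ \<phi>]) auto
next
  case (insert z B)
  then obtain F1 \<phi>1 where 1: "partial_embedding F1 \<phi>1" "F \<subseteq> F1" "B \<subseteq> F1" "\<forall>x\<in>F. \<phi>1 x = \<phi> x"
    by blast
  interpret F1: partial_embedding F1 \<phi>1 by fact
  obtain p where p: "F1.minimal_poly z p"
    using F1.minimal_poly_exists[OF alg] by blast
  have "\<not> constant (poly (map_poly \<phi>1 p))"
    using F1.minimal_poly_map_degree[OF p] by (simp add: constant_degree)
  then obtain r where r: "poly (map_poly \<phi>1 p) r = 0"
    using fundamental_theorem_of_algebra by blast
  from F1.extend_by_root[OF p r] obtain F' \<phi>' where
    "partial_embedding F' \<phi>'" "F1 \<subseteq> F'" "z \<in> F'" "\<And>x. x \<in> F1 \<Longrightarrow> \<phi>' x = \<phi>1 x"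
    by metis
  with 1 show ?case
    by (intro exI[of _ F'] exI[of _ \<phi>']) (auto simp: subset_iff)
qed

end

text \<open>Adjoining a finite rational basis of K exhausts K.\<close>

lemma partial_embedding_extends:
  fixes F :: "'k :: field_char_0 set"
  assumes nf: "number_field TYPE('k)" and "partial_embedding F \<phi>"
  shows "\<exists>\<sigma>. field_embedding \<sigma> \<and> (\<forall>x\<in>F. \<sigma> x = \<phi> x)"
proof -
  interpret partial_embedding F \<phi> by fact
  from nf obtain B where "finite_dimensional_vector_space (\<lambda>(q::rat) (x::'k). of_rat q * x) B"
    by (auto simp: number_field_def)
  then interpret fd: finite_dimensional_vector_space "\<lambda>(q::rat) (x::'k). of_rat q * x" B .
  obtain F' \<sigma> where 1: "partial_embedding F' \<sigma>" "B \<subseteq> F'" "\<forall>x\<in>F. \<sigma> x = \<phi> x"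
    using extend_to_finite[OF number_field_algebraic[OF nf] fd.finite_Basis] by blast
  interpret F': partial_embedding F' \<sigma> by fact
  have "x \<in> F'" for x
  proof -
    have "x \<in> fd.span B"
      by (simp add: fd.span_Basis)
    thus ?thesis
      by (induction rule: fd.span_induct_alt)
        (use 1(2) in \<open>auto simp: F'.zero_closed intro!: F'.add_closed F'.mult_closed F'.rat_closed\<close>)
  qed
  hence "field_embedding \<sigma>"
    by (simp add: field_embedding_def F'.map_one F'.map_add F'.map_mult)
  with 1 show ?thesis by blast
qed

text \<open>The polynomial is the minimal polynomial of \<open>y\<close> over the rationals, carried
  to the complex numbers. Sending \<open>y\<close> to any of its roots defines an embedding of Q(y),
  which extends to K.\<close>

lemma conjugates_polynomial:
  fixes y :: "'k :: field_char_0"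
  assumes nf: "number_field TYPE('k)"
  obtains p :: "complex poly" where "lead_coeff p = 1" and "degree p > 0"
    and "\<And>i. coeff p i \<in> \<rat>"
    and "\<And>r. poly p r = 0 \<Longrightarrow> \<exists>\<sigma>. field_embedding \<sigma> \<and> \<sigma> y = r"
proof -
  \<comment> \<open>The copy of the rationals in K is identified with the one in the complex
    numbers. Even at other arguments the value is rational, which gives rational coefficients
    below.\<close>
  define \<phi> where "\<phi> = (\<lambda>x::'k. of_rat (inv_into UNIV of_rat x) :: complex)"
  have \<phi>: "\<phi> (of_rat q) = of_rat q" for q
    by (simp add: \<phi>_def inv_f_f inj_on_def)
  interpret partial_embedding "\<rat>" \<phi>
  proof
    fix x y :: 'k assume "x \<in> \<rat>" "y \<in> \<rat>"
    then obtain a b where "x = of_rat a" "y = of_rat b"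
      by (auto elim!: Rats_cases)
    thus "\<phi> (x + y) = \<phi> x + \<phi> y" "\<phi> (x * y) = \<phi> x * \<phi> y"
      by (simp_all add: \<phi> of_rat_add of_rat_mult flip: of_rat_add of_rat_mult)
  qed (simp_all add: \<phi>)
  obtain p where p: "minimal_poly y p"
    using minimal_poly_exists[OF number_field_algebraic[OF nf]] by blast
  show ?thesis
  proof (rule that[of "map_poly \<phi> p"])
    show "lead_coeff (map_poly \<phi> p) = 1" "degree (map_poly \<phi> p) > 0"
      using minimal_poly_map_degree[OF p] by auto
    show "coeff (map_poly \<phi> p) i \<in> \<rat>" for i
      by (simp add: coeff_map_poly) (simp add: \<phi>_def)
    show "\<exists>\<sigma>. field_embedding \<sigma> \<and> \<sigma> y = r" if r: "poly (map_poly \<phi> p) r = 0" for r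
      using extend_by_root[OF p r] partial_embedding_extends[OF nf] by metis
  qed
qed

subsection \<open>Integers with small conjugates\<close>

lemma totally_real_embedding_of_real:
  fixes \<sigma> :: "'k :: field_char_0 \<Rightarrow> complex"
  assumes "totally_real TYPE('k)" and "field_embedding \<sigma>"
  obtains \<tau> :: "'k \<Rightarrow> real" where "field_embedding \<tau>" and "\<And>x. \<sigma> x = of_real (\<tau> x)"
proof -
  have real: "\<sigma> x = of_real (Re (\<sigma> x))" for x
    using assms by (metis of_real_Re rangeI subsetD totally_real_def)
  have "field_embedding (\<lambda>x. Re (\<sigma> x))"
    using assms(2) real unfolding field_embedding_def
    by (metis Re_complex_of_real of_real_mult one_complex.sel(1) plus_complex.sel(1))
  thus ?thesis using real by (rule that)
qed

text \<open>The product of the conjugates of \<open>y\<close> is a nonzero rational algebraic integer, so not all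
  conjugates can be smaller than 1.\<close>

lemma conjugate_of_abs_one:
  fixes y :: "'k :: field_char_0"
  assumes nf: "number_field TYPE('k)" and tr: "totally_real TYPE('k)"
    and y: "algebraic_int y" "y \<noteq> 0"
    and le: "\<And>\<sigma> :: 'k \<Rightarrow> real. field_embedding \<sigma> \<Longrightarrow> \<bar>\<sigma> y\<bar> \<le> 1"
  shows "\<exists>\<sigma> :: 'k \<Rightarrow> real. field_embedding \<sigma> \<and> \<bar>\<sigma> y\<bar> = 1"
proof -
  obtain p :: "complex poly" where p: "lead_coeff p = 1" "degree p > 0" "\<And>i. coeff p i \<in> \<rat>"
    and roots: "\<And>r. poly p r = 0 \<Longrightarrow> \<exists>\<sigma>. field_embedding \<sigma> \<and> \<sigma> y = r"
    using conjugates_polynomial[OF nf] by blast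
  obtain root where root: "Polynomial.smult (lead_coeff p) (\<Prod>i<degree p. [:- root i, 1:]) = p"
    using complex_poly_decompose' by blast
  have p_eq: "p = (\<Prod>i<degree p. [:- root i, 1:])"
    using root p(1) by simp
  have conj: "\<exists>\<tau> :: 'k \<Rightarrow> real. field_embedding \<tau> \<and> root i = of_real (\<tau> y)" if "i < degree p" for i
  proof -
    have "poly p (root i) = 0"
      using that by (subst p_eq) (auto simp: poly_prod)
    then obtain \<sigma> :: "'k \<Rightarrow> complex" where "field_embedding \<sigma>" "\<sigma> y = root i"
      using roots by blast
    thus ?thesis
      using totally_real_embedding_of_real[OF tr] by metis
  qed
  have prod: "poly p 0 = (\<Prod>i<degree p. - root i)"
    by (subst p_eq) (simp add: poly_prod)
  have "algebraic_int (\<Prod>i\<in>I. - root i)" if "I \<subseteq> {..<degree p}" for I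
    using finite_subset[OF that finite_lessThan] that
  proof induction
    case (insert i I)
    then obtain \<tau> :: "'k \<Rightarrow> real" where "field_embedding \<tau>" "root i = of_real (\<tau> y)"
      using conj[of i] by auto
    hence "algebraic_int (root i)"
      using field_embedding_algebraic_int[OF _ y(1)] by auto
    thus ?case
      using insert by (simp add: algebraic_int_mult)
  qed simp
  hence "algebraic_int (poly p 0)"
    by (simp add: prod)
  moreover have "poly p 0 \<in> \<rat>"
    using p(3)[of 0] by (simp add: poly_0_coeff_0)
  ultimately have "poly p 0 \<in> \<int>"
    by (rule rational_algebraic_int_is_int)
  moreover have "poly p 0 \<noteq> 0"
    using conj y(2) by (auto simp: prod) (metis field_embedding_eq_0_iff of_real_eq_0_iff)
  ultimately have "norm (poly p 0) \<ge> 1"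
    by (auto elim!: Ints_cases simp flip: of_int_abs)
  hence ge: "1 \<le> (\<Prod>i<degree p. norm (root i))"
    by (simp add: prod prod_norm [symmetric])
  have le1: "norm (root i) \<le> 1" if "i < degree p" for i
    using conj[OF that] le by auto
  \<comment> \<open>The other factors have product at most 1, so a total product of at least 1
    forces this root to have modulus 1.\<close>
  have "(\<Prod>i<degree p. norm (root i)) = norm (root 0) * (\<Prod>i\<in>{..<degree p} - {0}. norm (root i))"
    using p(2) by (intro prod.remove) auto
  also have "\<dots> \<le> norm (root 0) * 1"
    using le1 by (intro mult_left_mono prod_le_1) auto
  finally have "norm (root 0) = 1"
    using ge le1[OF p(2)] by simp
  thus ?thesis
    using conj[OF p(2)] by auto
qed

lemma square_le_two_cases:
  fixes t :: "'k :: field_char_0"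
  assumes nf: "number_field TYPE('k)" and tr: "totally_real TYPE('k)"
    and t: "t \<in> ring_of_integers"
    and le: "\<And>\<sigma> :: 'k \<Rightarrow> real. field_embedding \<sigma> \<Longrightarrow> (\<sigma> t)\<^sup>2 \<le> 2"
  shows "t = 0 \<or> t\<^sup>2 = 1 \<or> t\<^sup>2 = 2"
proof (rule ccontr)
  assume not: "\<not> ?thesis"
  define y where "y = t * t * (2 - t * t)"
  have y_eq: "y = 1 - (t\<^sup>2 - 1)\<^sup>2"
    by (simp add: y_def power2_eq_square algebra_simps)
  have "y \<noteq> 0"
    using not by (auto simp: y_def power2_eq_square)
  have "algebraic_int y"
  proof -
    have "y \<in> ring_of_integers"
      using t ring_of_integers_of_int[of 2]
      by (auto simp: y_def intro!: ring_of_integers_mult ring_of_integers_diff)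
    thus ?thesis by (simp add: ring_of_integers_def)
  qed
  have val: "\<sigma> y = 1 - ((\<sigma> t)\<^sup>2 - 1)\<^sup>2" if "field_embedding \<sigma>" for \<sigma> :: "'k \<Rightarrow> real"
  proof -
    interpret comm_ring_hom \<sigma>
      by (rule field_embedding_imp_comm_ring_hom[OF that])
    show ?thesis
      by (simp add: y_eq hom_power hom_minus)
  qed
  have "\<bar>\<sigma> y\<bar> \<le> 1" if "field_embedding \<sigma>" for \<sigma> :: "'k \<Rightarrow> real"
  proof -
    have "((\<sigma> t)\<^sup>2 - 1)\<^sup>2 \<le> 1"
      using le[OF that] by (simp add: power2_le_iff_abs_le abs_square_le_1 abs_le_iff)
    thus ?thesis
      by (simp add: val[OF that] abs_le_iff)
  qed
  then obtain \<sigma> :: "'k \<Rightarrow> real" where \<sigma>: "field_embedding \<sigma>" "\<bar>\<sigma> y\<bar> = 1"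
    using conjugate_of_abs_one[OF nf tr \<open>algebraic_int y\<close> \<open>y \<noteq> 0\<close>] by blast
  interpret comm_ring_hom \<sigma>
    by (rule field_embedding_imp_comm_ring_hom[OF \<sigma>(1)])
  have "((\<sigma> t)\<^sup>2 - 1)\<^sup>2 \<le> 1"
    using le[OF \<sigma>(1)] by (simp add: abs_square_le_1 abs_le_iff)
  \<comment> \<open>\<open>\<sigma> y\<close> is 1 minus a number in [0, 1], so absolute value 1
    leaves only 0 for that number. Injectivity of \<open>\<sigma>\<close> then gives
    \<open>t\<^sup>2 = 1\<close>, which was excluded.\<close>
  hence "((\<sigma> t)\<^sup>2 - 1)\<^sup>2 = 0"
    using \<sigma> val[OF \<sigma>(1)] by (auto simp: abs_if split: if_splits)
  hence "\<sigma> (t\<^sup>2 - 1) = 0"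
    by (simp add: hom_power hom_minus)
  thus False
    using not field_embedding_eq_0_iff[OF \<sigma>(1)] by simp
qed

lemma totally_positive_one_two:
  "1 \<in> (totally_positive_integers :: 'k::field_char_0 set)"
  "2 \<in> (totally_positive_integers :: 'k set)"
proof -
  have two: "\<sigma> 2 = 2" if "field_embedding \<sigma>" for \<sigma> :: "'k \<Rightarrow> real"
    using that by (metis field_embedding_def one_add_one)
  show "1 \<in> (totally_positive_integers :: 'k set)" "2 \<in> (totally_positive_integers :: 'k set)"
    using ring_of_integers_of_int[of 1] ring_of_integers_of_int[of 2]
    by (simp_all add: totally_positive_integers_def two) (simp add: field_embedding_def)
qed

text \<open>Dropping \<open>r\<close> and dividing by the positive \<open>\<sigma> D\<close> bounds
  every conjugate of \<open>t\<^sup>2\<close> by 2. The lemma is used with \<open>D = 1\<close> to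
  find the orthogonal pair and later with the determinant of the form.\<close>

lemma totally_positive_mult_square_cases:
  fixes D r t :: "'k :: field_char_0"
  assumes nf: "number_field TYPE('k)" and tr: "totally_real TYPE('k)"
    and no_sqrt2: "\<nexists>s::'k. s\<^sup>2 = 2"
    and D: "D \<in> totally_positive_integers" and t: "t \<in> ring_of_integers"
    and eq: "2 * D = r + D * t\<^sup>2"
    and r: "\<And>\<sigma> :: 'k \<Rightarrow> real. field_embedding \<sigma> \<Longrightarrow> 0 \<le> \<sigma> r"
  shows "t = 0 \<or> t\<^sup>2 = 1"
proof -
  have "(\<sigma> t)\<^sup>2 \<le> 2" if "field_embedding \<sigma>" for \<sigma> :: "'k \<Rightarrow> real"
  proof -
    interpret comm_ring_hom \<sigma>
      by (rule field_embedding_imp_comm_ring_hom[OF that])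
    have "2 * \<sigma> D = \<sigma> r + \<sigma> D * (\<sigma> t)\<^sup>2"
      using arg_cong[OF eq, of \<sigma>] by (simp add: hom_distribs)
    hence "\<sigma> D * (\<sigma> t)\<^sup>2 \<le> \<sigma> D * 2"
      using r[OF that] by linarith
    moreover have "\<sigma> D > 0"
      using D that by (auto simp: totally_positive_integers_def)
    ultimately show ?thesis by simp
  qed
  thus ?thesis
    using square_le_two_cases[OF nf tr t] no_sqrt2 by blast
qed

subsection \<open>Ternary forms\<close>

definition dot3 :: "(nat \<Rightarrow> 'a::comm_ring_1) \<Rightarrow> (nat \<Rightarrow> 'a) \<Rightarrow> 'a" where
  "dot3 u v = u 0 * v 0 + u 1 * v 1 + u 2 * v 2"

definition cross3 :: "(nat \<Rightarrow> 'a::comm_ring_1) \<Rightarrow> (nat \<Rightarrow> 'a) \<Rightarrow> nat \<Rightarrow> 'a" where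
  "cross3 u v i =
     (if i = 0 then u 1 * v 2 - u 2 * v 1
      else if i = 1 then u 2 * v 0 - u 0 * v 2
      else u 0 * v 1 - u 1 * v 0)"

definition det3 :: "(nat \<Rightarrow> 'a::comm_ring_1) \<Rightarrow> (nat \<Rightarrow> 'a) \<Rightarrow> (nat \<Rightarrow> 'a) \<Rightarrow> 'a" where
  "det3 u v w = dot3 (cross3 u v) w"

lemma det3_mult:
  "det3 (\<lambda>i. dot3 (p i) a) (\<lambda>i. dot3 (p i) b) (\<lambda>i. dot3 (p i) c) =
     det3 (p 0) (p 1) (p 2) * det3 a b c"
  unfolding det3_def dot3_def cross3_def by (simp add: algebra_simps)

lemma det3_mult_transpose:
  "det3 (\<lambda>i. dot3 a ([p, q, r] ! i)) (\<lambda>i. dot3 b ([p, q, r] ! i)) (\<lambda>i. dot3 c ([p, q, r] ! i)) =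
     det3 a b c * det3 p q r"
  unfolding det3_def dot3_def cross3_def by (simp add: numeral_2_eq_2 algebra_simps)

lemma dot3_cross3_self: "dot3 u (cross3 u v) = 0" "dot3 v (cross3 u v) = 0"
  unfolding dot3_def cross3_def by (simp_all add: algebra_simps)

text \<open>The Binet-Cauchy identity for cross products.\<close>

lemma det3_cross3: "det3 a b (cross3 c d) = dot3 a c * dot3 b d - dot3 a d * dot3 b c"
  unfolding det3_def dot3_def cross3_def by (simp add: algebra_simps)

lemma integral_vector_3_iff:
  "integral_vector 3 v \<longleftrightarrow> v 0 \<in> ring_of_integers \<and> v 1 \<in> ring_of_integers \<and> v 2 \<in> ring_of_integers"
  by (auto simp: integral_vector_def numeral_3_eq_3 less_Suc_eq numeral_2_eq_2)

lemma integral_cross3: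
  "integral_vector 3 u \<Longrightarrow> integral_vector 3 v \<Longrightarrow> integral_vector 3 (cross3 u v)"
  by (auto simp: integral_vector_3_iff cross3_def intro!: ring_of_integers_mult ring_of_integers_diff)

lemma integral_dot3:
  "integral_vector 3 u \<Longrightarrow> integral_vector 3 v \<Longrightarrow> dot3 u v \<in> ring_of_integers"
  by (auto simp: integral_vector_3_iff dot3_def intro!: ring_of_integers_mult ring_of_integers_add)

lemma integral_det3:
  "integral_vector 3 u \<Longrightarrow> integral_vector 3 v \<Longrightarrow> integral_vector 3 w \<Longrightarrow> det3 u v w \<in> ring_of_integers"
  by (simp add: det3_def integral_dot3 integral_cross3)

section \<open>Gram matrices and universal ternary forms\<close>

definition gram_vec :: "(nat \<Rightarrow> nat \<Rightarrow> 'a::comm_ring_1) \<Rightarrow> (nat \<Rightarrow> 'a) \<Rightarrow> nat \<Rightarrow> 'a" where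
  "gram_vec g u i = dot3 (g i) u"

definition bilin :: "(nat \<Rightarrow> nat \<Rightarrow> 'a::comm_ring_1) \<Rightarrow> (nat \<Rightarrow> 'a) \<Rightarrow> (nat \<Rightarrow> 'a) \<Rightarrow> 'a" where
  "bilin g u v = dot3 (gram_vec g u) v"

text \<open>If M has columns \<open>a, b, c\<close> and G has rows \<open>g i\<close>, the
  determinant on the left is that of the transpose of M times G times M, up to
  transposition.\<close>

lemma gram_determinant:
  "det3 (\<lambda>i. bilin g a ([a, b, c] ! i)) (\<lambda>i. bilin g b ([a, b, c] ! i)) (\<lambda>i. bilin g c ([a, b, c] ! i)) =
     det3 (g 0) (g 1) (g 2) * (det3 a b c)\<^sup>2"
  using det3_mult[of g a b c]
  by (simp add: bilin_def det3_mult_transpose gram_vec_def [abs_def] power2_eq_square mult.assoc)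

text \<open>A classical form is one with integral Gram matrix \<open>g\<close>, so the hypotheses
  are restated for the symmetric bilinear form of \<open>g\<close>.\<close>

locale universal_ternary =
  fixes g :: "nat \<Rightarrow> nat \<Rightarrow> 'k::field_char_0"
  assumes nf: "number_field TYPE('k)" and tr: "totally_real TYPE('k)"
    and no_sqrt2: "\<nexists>s::'k. s\<^sup>2 = 2"
    and sym: "g i j = g j i"
    and integral: "i < 3 \<Longrightarrow> integral_vector 3 (g i)"
    and positive: "integral_vector 3 v \<Longrightarrow> \<exists>i<3. v i \<noteq> 0 \<Longrightarrow>
      bilin g v v \<in> totally_positive_integers"
    and universal: "x \<in> totally_positive_integers \<Longrightarrow> \<exists>v. integral_vector 3 v \<and> bilin g v v = x"
begin

abbreviation B where "B \<equiv> bilin g"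
definition D where "D = det3 (g 0) (g 1) (g 2)"

lemma B_commute: "B u v = B v u"
  unfolding bilin_def gram_vec_def dot3_def sym[of 1 0] sym[of 2 0] sym[of 2 1]
  by (simp add: algebra_simps)

lemma B_zero_iff: "integral_vector 3 v \<Longrightarrow> B v v = 0 \<Longrightarrow> i < 3 \<Longrightarrow> v i = 0"
proof (rule ccontr)
  assume v: "integral_vector 3 v" "B v v = 0" "i < 3" "v i \<noteq> 0"
  hence 0: "0 \<in> (totally_positive_integers :: 'k set)"
    using positive[OF v(1)] by auto
  \<comment> \<open>Total positivity of 0 is absurd once some real embedding exists; the result on
    conjugates, applied to 1, supplies one.\<close>
  obtain \<sigma> :: "'k \<Rightarrow> real" where \<sigma>: "field_embedding \<sigma>"
    using conjugate_of_abs_one[OF nf tr, of 1] by (auto simp: field_embedding_def)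
  show False
    using 0 \<sigma> field_embedding_zero[OF \<sigma>] by (auto simp: totally_positive_integers_def)
qed

lemma integral_gram_vec: "integral_vector 3 v \<Longrightarrow> integral_vector 3 (gram_vec g v)"
  using integral by (auto simp: integral_vector_def[of 3 "gram_vec g v"] gram_vec_def integral_dot3)

lemma integral_B: "integral_vector 3 u \<Longrightarrow> integral_vector 3 v \<Longrightarrow> B u v \<in> ring_of_integers"
  by (simp add: bilin_def integral_dot3 integral_gram_vec)

lemma integral_D: "D \<in> ring_of_integers"
  unfolding D_def by (intro integral_det3 integral) auto

text \<open>Since \<open>e\<close> has norm 1, removing from a vector \<open>v\<close> of norm 2 its
  component along \<open>e\<close> needs no denominators. The remainder \<open>f\<close> has norm
  \<open>2 - x\<^sup>2\<close>.\<close>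

lemma orthogonal_pair_exists:
  obtains e f c where "integral_vector 3 e" "integral_vector 3 f"
    "B e e = 1" "B e f = 0" "B f f = c" "c = 1 \<or> c = 2"
proof -
  obtain e where e: "integral_vector 3 e" "B e e = 1"
    using universal totally_positive_one_two(1) by blast
  obtain v where v: "integral_vector 3 v" "B v v = 2"
    using universal totally_positive_one_two(2) by blast
  define x where "x = B v e"
  define f where "f = (\<lambda>i. v i - x * e i)"
  have x: "x \<in> ring_of_integers"
    unfolding x_def by (intro integral_B v e)
  have f: "integral_vector 3 f"
    using v e x by (auto simp: integral_vector_def f_def intro!: ring_of_integers_diff ring_of_integers_mult)
  have lin: "B u f = B u v - x * B u e" for u
    by (simp add: bilin_def dot3_def f_def algebra_simps)
  have "B e f = 0"
    using e by (simp add: lin x_def B_commute[of v e])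
  have "B f f = B v f"
    using lin[of v] lin[of f] \<open>B e f = 0\<close> B_commute by simp
  hence eq: "B f f = 2 - x\<^sup>2"
    using v by (simp add: lin x_def power2_eq_square)
  have "x = 0 \<or> x\<^sup>2 = 1"
  proof (rule totally_positive_mult_square_cases[OF nf tr no_sqrt2 totally_positive_one_two(1) x])
    show "2 * 1 = B f f + 1 * x\<^sup>2"
      by (simp add: eq)
    fix \<sigma> :: "'k \<Rightarrow> real" assume \<sigma>: "field_embedding \<sigma>"
    \<comment> \<open>If \<open>f\<close> vanished, \<open>2 = x\<^sup>2\<close> would be a
      square.\<close>
    have "\<exists>i<3. f i \<noteq> 0"
    proof (rule ccontr)
      assume "\<not> ?thesis"
      hence "B f f = 0"
        by (simp add: bilin_def dot3_def)
      thus False using no_sqrt2 eq by simp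
    qed
    thus "0 \<le> \<sigma> (B f f)"
      using positive[OF f] \<sigma> by (auto simp: totally_positive_integers_def less_imp_le)
  qed
  hence "B f f = 1 \<or> B f f = 2"
    using eq by auto
  with e f \<open>B e f = 0\<close> show ?thesis by (intro that) auto
qed

context
  fixes e f c
  assumes e: "integral_vector 3 e" and f: "integral_vector 3 f"
    and ee: "B e e = 1" and ef: "B e f = 0" and ff: "B f f = c"
    and c: "c = 1 \<or> c = 2"
begin

text \<open>Expansion of the Gram determinant of \<open>e, f, u\<close> along its first row.\<close>

lemma decomposition: "c * B u u = c * (B u e)\<^sup>2 + (B u f)\<^sup>2 + D * (det3 e f u)\<^sup>2"
proof -
  have "D * (det3 e f u)\<^sup>2 =
      B e e * (B f f * B u u - B f u * B u f) - B e f * (B f e * B u u - B f u * B u e)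
      + B e u * (B f e * B u f - B f f * B u e)"
    unfolding D_def gram_determinant[symmetric]
    by (simp add: det3_def dot3_def cross3_def numeral_2_eq_2 algebra_simps)
  thus ?thesis
    unfolding B_commute[of e u] B_commute[of f u] B_commute[of f e] ee ef ff
    by (simp add: power2_eq_square algebra_simps)
qed

text \<open>The cross product \<open>w\<close> of \<open>gram_vec g e\<close> and
  \<open>gram_vec g f\<close> is orthogonal to \<open>e\<close> and \<open>f\<close>, and
  \<open>det3 e f w = c\<close> by Binet-Cauchy. So \<open>w\<close> is a nonzero integral vector of
  norm \<open>c * D\<close>.\<close>

lemma D_totally_positive: "D \<in> totally_positive_integers"
proof -
  define w where "w = cross3 (gram_vec g e) (gram_vec g f)"
  have w: "integral_vector 3 w"
    unfolding w_def by (intro integral_cross3 integral_gram_vec e f)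
  have perp: "B w e = 0" "B w f = 0"
    unfolding B_commute[of w] by (simp_all add: bilin_def w_def dot3_cross3_self)
  have dot_comm: "dot3 u v = dot3 v u" for u v :: "nat \<Rightarrow> 'k"
    by (simp add: dot3_def mult.commute)
  have "det3 e f w = B e e * B f f - B f e * B e f"
    by (simp add: w_def det3_cross3 bilin_def dot_comm)
  hence det: "det3 e f w = c"
    by (simp add: ee ff ef)
  have "c \<noteq> 0" using c by auto
  have "c * B w w = c * (c * D)"
    using decomposition[of w] by (simp add: perp det power2_eq_square mult_ac)
  hence eq: "B w w = c * D"
    using \<open>c \<noteq> 0\<close> by simp
  have "\<exists>i<3. w i \<noteq> 0"
  proof (rule ccontr)
    assume "\<not> ?thesis"
    hence "det3 e f w = 0"
      by (simp add: det3_def dot3_def)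
    thus False using det \<open>c \<noteq> 0\<close> by simp
  qed
  hence pos: "c * D \<in> totally_positive_integers"
    using positive[OF w] eq by simp
  have "0 < \<sigma> D" if \<sigma>: "field_embedding \<sigma>" for \<sigma> :: "'k \<Rightarrow> real"
  proof -
    have "\<sigma> c > 0"
      using c totally_positive_one_two \<sigma> by (auto simp: totally_positive_integers_def)
    moreover have "0 < \<sigma> c * \<sigma> D"
      using pos \<sigma> by (auto simp: totally_positive_integers_def field_embedding_def)
    ultimately show ?thesis
      by (simp add: zero_less_mult_iff)
  qed
  thus ?thesis
    by (simp add: totally_positive_integers_def integral_D)
qed

lemma det_cases:
  assumes "2 * D = c * x\<^sup>2 + y\<^sup>2 + D * t\<^sup>2" and "t \<in> ring_of_integers"
  shows "t = 0 \<or> t\<^sup>2 = 1"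
proof (rule totally_positive_mult_square_cases[OF nf tr no_sqrt2 D_totally_positive assms(2,1)])
  fix \<sigma> :: "'k \<Rightarrow> real" assume \<sigma>: "field_embedding \<sigma>"
  interpret comm_ring_hom \<sigma>
    by (rule field_embedding_imp_comm_ring_hom[OF \<sigma>])
  have "\<sigma> c > 0"
    using c totally_positive_one_two \<sigma> by (auto simp: totally_positive_integers_def)
  thus "0 \<le> \<sigma> (c * x\<^sup>2 + y\<^sup>2)"
    by (simp add: hom_distribs)
qed

text \<open>Here \<open>c u = c B(u,e) e + B(u,f) f\<close>. For \<open>c = 2\<close> the coefficient \<open>B(u,f) / 2\<close> of \<open>f\<close> in \<open>u\<close>
  need not be integral, but its product with any value of \<open>det(e,f,_)\<close> is.\<close>

lemma mult_det_eq_if_det_eq_0: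
  assumes u: "integral_vector 3 u" and det: "det3 e f u = 0"
  shows "B u f * det3 e f v = c * det3 e u v"
proof -
  \<comment> \<open>This is \<open>c\<close> times the component of \<open>u\<close> orthogonal to
    \<open>e\<close> and \<open>f\<close>. As \<open>u\<close> has determinant 0 with them, so has
    \<open>z\<close>; by the decomposition \<open>z\<close> has norm 0 and vanishes.\<close>
  define z where "z = (\<lambda>i. c * u i - c * B u e * e i - B u f * f i)"
  have "c \<in> ring_of_integers"
    using c totally_positive_one_two by (auto simp: totally_positive_integers_def)
  hence z: "integral_vector 3 z"
    using u e f integral_B[OF u e] integral_B[OF u f]
    by (auto simp: integral_vector_def z_def intro!: ring_of_integers_diff ring_of_integers_mult)
  have lin: "B w z = c * B w u - c * B u e * B w e - B u f * B w f" for w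
    by (simp add: bilin_def dot3_def z_def algebra_simps)
  have "B e z = 0" "B f z = 0"
    using ee ef ff by (simp_all add: lin B_commute[of e u] B_commute[of f u] B_commute[of f e])
  moreover have "det3 e f z = c * det3 e f u"
    unfolding z_def det3_def dot3_def cross3_def by (simp add: algebra_simps)
  ultimately have "c * B z z = 0"
    using decomposition[of z] det by (simp add: B_commute[of z e] B_commute[of z f])
  hence "z i = 0" if "i < 3" for i
    using B_zero_iff[OF z _ that] c by auto
  hence "z 0 = 0" "z 1 = 0" "z 2 = 0" by simp_all
  \<comment> \<open>Linearity in the middle argument; the multiple of \<open>e\<close> in
    \<open>z\<close> contributes nothing.\<close>
  moreover have "c * det3 e u v - B u f * det3 e f v = det3 e z v"
    unfolding z_def det3_def dot3_def cross3_def by (simp add: algebra_simps)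
  ultimately show ?thesis
    by (simp add: det3_def dot3_def cross3_def)
qed

end

lemma two_mult_represented:
  fixes \<beta> :: 'k
  assumes "\<beta> \<in> totally_positive_integers"
  shows "\<exists>x y z w. {x, y, z, w} \<subseteq> ring_of_integers \<and> 2 * \<beta> = x\<^sup>2 + y\<^sup>2 + 2 * z\<^sup>2 + 2 * w\<^sup>2"
proof -
  obtain e f c where ef: "integral_vector 3 e" "integral_vector 3 f"
    "B e e = 1" "B e f = 0" "B f f = c" "c = 1 \<or> c = 2"
    by (rule orthogonal_pair_exists)
  note decomp = decomposition[OF ef] and D_pos = D_totally_positive[OF ef]
    and cases = det_cases[OF ef]
  obtain v where v: "integral_vector 3 v" "B v v = \<beta>"
    using universal assms by blast
  define X Y T where "X = B v e" and "Y = B v f" and "T = det3 e f v"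
  have XYT: "X \<in> ring_of_integers" "Y \<in> ring_of_integers" "T \<in> ring_of_integers"
    unfolding X_def Y_def T_def using v ef by (auto intro: integral_B integral_det3)
  have \<beta>: "c * \<beta> = c * X\<^sup>2 + Y\<^sup>2 + D * T\<^sup>2"
    using decomp[of v] v by (simp add: X_def Y_def T_def)
  note closed = ring_of_integers_mult ring_of_integers_add ring_of_integers_diff
  show ?thesis
    using ef(6)
  proof
    assume c1: "c = 1"
    have "2 * D \<in> totally_positive_integers"
      using D_pos totally_positive_one_two(2)
      by (auto simp: totally_positive_integers_def field_embedding_def ring_of_integers_mult)
    then obtain u where u: "integral_vector 3 u" "B u u = 2 * D"
      using universal by blast
    define x y t where "x = B u e" and "y = B u f" and "t = det3 e f u"
    have xyt: "x \<in> ring_of_integers" "y \<in> ring_of_integers" "t \<in> ring_of_integers"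
      unfolding x_def y_def t_def using u ef by (auto intro: integral_B integral_det3)
    have D2: "2 * D = x\<^sup>2 + y\<^sup>2 + D * t\<^sup>2"
      using decomp[of u] u c1 by (simp add: x_def y_def t_def)
    from cases[of x y t] D2 c1 xyt consider "t = 0" | "t\<^sup>2 = 1"
      by auto
    thus ?thesis
    proof cases
      case 1
      \<comment> \<open>Now \<open>2 * D = x\<^sup>2 + y\<^sup>2\<close>, and multiplying by
        \<open>T\<^sup>2\<close> suffices.\<close>
      have "2 * \<beta> = 2 * X\<^sup>2 + 2 * Y\<^sup>2 + 2 * D * T\<^sup>2"
        using \<beta> c1 by (simp add: algebra_simps)
      also have "\<dots> = (x * T)\<^sup>2 + (y * T)\<^sup>2 + 2 * X\<^sup>2 + 2 * Y\<^sup>2"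
        using D2 1 by (simp add: power_mult_distrib algebra_simps)
      finally show ?thesis
        using XYT xyt
        by (intro exI[of _ "x * T"] exI[of _ "y * T"] exI[of _ X] exI[of _ Y]) (auto intro: closed)
    next
      case 2
      hence "D = x\<^sup>2 + y\<^sup>2"
        using D2 by simp
      \<comment> \<open>Twice a sum of two squares is the sum of the squares of \<open>x + y\<close>
        and \<open>x - y\<close>.\<close>
      hence "2 * \<beta> = ((x + y) * T)\<^sup>2 + ((x - y) * T)\<^sup>2 + 2 * X\<^sup>2 + 2 * Y\<^sup>2"
        using \<beta> c1 by (simp add: power2_eq_square algebra_simps)
      thus ?thesis
        using XYT xyt
        by (intro exI[of _ "(x + y) * T"] exI[of _ "(x - y) * T"] exI[of _ X] exI[of _ Y])
          (auto intro: closed)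
    qed
  next
    assume c2: "c = 2"
    \<comment> \<open>Norm \<open>D\<close> rather than \<open>2 * D\<close>, because the
      decomposition already carries the factor \<open>c = 2\<close>.\<close>
    obtain u where u: "integral_vector 3 u" "B u u = D"
      using universal D_pos by blast
    define x y t where "x = B u e" and "y = B u f" and "t = det3 e f u"
    have xyt: "x \<in> ring_of_integers" "y \<in> ring_of_integers" "t \<in> ring_of_integers"
      unfolding x_def y_def t_def using u ef by (auto intro: integral_B integral_det3)
    have D2: "2 * D = 2 * x\<^sup>2 + y\<^sup>2 + D * t\<^sup>2"
      using decomp[of u] u c2 by (simp add: x_def y_def t_def)
    from cases[of x y t] D2 c2 xyt consider "t = 0" | "t\<^sup>2 = 1"
      by auto
    thus ?thesis
    proof cases
      case 1
      \<comment> \<open>Here \<open>2 * D = 2 * x\<^sup>2 + y\<^sup>2\<close>, where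
        \<open>y\<close> itself need not be even. The integer \<open>m\<close> is half of
        \<open>y * T\<close>, so \<open>D * T\<^sup>2\<close> becomes
        \<open>(x * T)\<^sup>2 + 2 * m\<^sup>2\<close>.\<close>
      define m where "m = det3 e u v"
      have m: "m \<in> ring_of_integers"
        unfolding m_def using u v ef by (intro integral_det3)
      have "y * T = 2 * m"
        using mult_det_eq_if_det_eq_0[OF ef u(1), of v] 1 c2
        by (simp add: y_def T_def m_def t_def)
      hence "(y * T)\<^sup>2 = 4 * m\<^sup>2"
        by (simp add: power_mult_distrib)
      hence "2 * (D * T\<^sup>2) = 2 * ((x * T)\<^sup>2 + 2 * m\<^sup>2)"
        using D2 1 by (simp add: power_mult_distrib distrib_right flip: mult.assoc)
      hence "D * T\<^sup>2 = (x * T)\<^sup>2 + 2 * m\<^sup>2"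
        by (simp only: mult_cancel_left) simp
      hence "2 * \<beta> = Y\<^sup>2 + (x * T)\<^sup>2 + 2 * X\<^sup>2 + 2 * m\<^sup>2"
        using \<beta> c2 by simp
      thus ?thesis
        using XYT xyt m
        by (intro exI[of _ Y] exI[of _ "x * T"] exI[of _ X] exI[of _ m]) (auto intro: closed)
    next
      case 2
      hence "D = 2 * x\<^sup>2 + y\<^sup>2"
        using D2 by simp
      hence "2 * \<beta> = Y\<^sup>2 + (y * T)\<^sup>2 + 2 * X\<^sup>2 + 2 * (x * T)\<^sup>2"
        using \<beta> c2 by (simp add: power_mult_distrib algebra_simps)
      thus ?thesis
        using XYT xyt
        by (intro exI[of _ Y] exI[of _ "y * T"] exI[of _ X] exI[of _ "x * T"]) (auto intro: closed)
    qed
  qed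
qed

end

section \<open>Passage from the coefficients of a classical form to its Gram matrix\<close>

theorem theorem4p1:
  assumes "number_field TYPE('k::field_char_0)"
    and "totally_real TYPE('k)"
    and "\<nexists>s::'k. s\<^sup>2 = 2"
    and "\<exists>a :: nat \<Rightarrow> nat \<Rightarrow> 'k. quadratic_form 3 a \<and> qf_classical 3 a \<and> qf_universal 3 a"
  shows "\<forall>x \<in> (\<lambda>y. 2 * y) ` (totally_positive_integers :: 'k set).
           qf_represents 4 (diagonal_form [1, 1, 2, 2]) x"
proof -
  obtain a :: "nat \<Rightarrow> nat \<Rightarrow> 'k" where
    a: "quadratic_form 3 a" "qf_classical 3 a" "qf_universal 3 a"
    using assms(4) by blast
  \<comment> \<open>Coefficients are stored for \<open>i \<le> j\<close> only, hence
    \<open>min\<close> and \<open>max\<close>. Each mixed term occurs twice in the bilinear form,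
    hence the halves, which are integral because the form is classical.\<close>
  define g where "g = (\<lambda>i j. if i = j then a i j else a (min i j) (max i j) / 2)"
  have sym: "g i j = g j i" for i j
    by (simp add: g_def min.commute max.commute)
  have off: "g i j \<in> ring_of_integers" if "i < j" "j < 3" for i j
    using a(2) that by (fastforce simp: qf_classical_def g_def)
  have "g i j \<in> ring_of_integers" if "i < 3" "j < 3" for i j
    using off[of i j] off[of j i] sym[of i j] a(1) that
    by (cases i j rule: linorder_cases) (auto simp: quadratic_form_def g_def)
  hence integral: "integral_vector 3 (g i)" if "i < 3" for i
    using that by (simp add: integral_vector_def)
  have eval: "qf_eval 3 a v = bilin g v v" for v
    by (simp add: qf_eval_def bilin_def gram_vec_def dot3_def g_def numeral_3_eq_3 numeral_2_eq_2
        atMost_Suc algebra_simps)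
  interpret universal_ternary g
    using assms(1-3) sym integral a(3)
    by unfold_locales (auto simp: qf_universal_def qf_positive_definite_def qf_represents_def eval
        simp flip: eval)
  show ?thesis
  proof (clarify, goal_cases)
    case (1 _ \<beta>)
    then obtain x y z w where xyzw: "{x, y, z, w} \<subseteq> ring_of_integers"
      "2 * \<beta> = x\<^sup>2 + y\<^sup>2 + 2 * z\<^sup>2 + 2 * w\<^sup>2"
      using two_mult_represented by blast
    show ?case
      unfolding qf_represents_def qf_eval_diagonal_1122
      using xyzw
      by (intro exI[of _ "\<lambda>i. [x, y, z, w] ! i"])
        (auto simp: integral_vector_def numeral_eq_Suc less_Suc_eq)
  qed
qed

end
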